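(* Let $\langle X,>\rangle$ be an abstract game. The supercore of $\langle X,>\rangle$ is equal to the grounded extension of $\langle X,>\rangle$ when viewed as an abstract argumentation framework (with set of arguments $X$ and attack relation $>$).
   Context: An abstract game is a pair $\langle X,>\rangle$ where $X$ is a set (of outcomes) and $>\,\subseteq X^2$ is a binary (domination) relation. For $S\subseteq X$ let $u(S)=X\setminus\{y\in X:\exists x\in S,\ x>y\}$. A subsolution is a set $S\subseteq X$ with $S\subseteq u(S)$ and $S=u(u(S))$. The supercore of an abstract game is the intersection of all its subsolutions. An abstract argumentation framework is a directed graph $\langle A,R\rangle$, $R\subseteq A^2$; $R(a,b)$ means $a$ attacks $b$. For $S\subseteq A$, let $S^+=\{b\in A:\exists a\in S,\ R(a,b)\}$, $n(S)=A\setminus S^+$, and let $d(S)$ be the set of $a\in A$ such that every $b\in A$ with $R(b,a)$ lies in $S^+$. $S$ is conflict-free iff $S\subseteq n(S)$, self-defending iff $S\subseteq d(S)$, admissible iff both, and a complete extension iff it is admissible and $d(S)\subseteq S$. The grounded extension is the $\subseteq$-least complete extension. *)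

theory Defs
  imports Main
begin

text \<open>A pair \<open>(x, y)\<close> in \<open>D\<close> means that \<open>x\<close> dominates \<open>y\<close>. The set \<open>X\<close> may be empty or infinite.\<close>

definition abstract_game :: "'a set \<Rightarrow> 'a rel \<Rightarrow> bool" where
  "abstract_game X D \<longleftrightarrow> D \<subseteq> X \<times> X"

definition undominated :: "'a set \<Rightarrow> 'a rel \<Rightarrow> 'a set \<Rightarrow> 'a set" where
  "undominated X D S = X - {y \<in> X. \<exists>x\<in>S. (x, y) \<in> D}"

definition subsolution :: "'a set \<Rightarrow> 'a rel \<Rightarrow> 'a set \<Rightarrow> bool" where
  "subsolution X D S \<longleftrightarrow>
     S \<subseteq> X \<and> S \<subseteq> undominated X D S \<and> S = undominated X D (undominated X D S)"

definition supercore :: "'a set \<Rightarrow> 'a rel \<Rightarrow> 'a set" where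
  "supercore X D = \<Inter> {S. subsolution X D S}"

text \<open>A pair \<open>(a, b)\<close> in \<open>R\<close> means that \<open>a\<close> attacks \<open>b\<close>.\<close>

definition attacked :: "'a set \<Rightarrow> 'a rel \<Rightarrow> 'a set \<Rightarrow> 'a set" where
  "attacked A R S = {b \<in> A. \<exists>a\<in>S. (a, b) \<in> R}"

definition neutral :: "'a set \<Rightarrow> 'a rel \<Rightarrow> 'a set \<Rightarrow> 'a set" where
  "neutral A R S = A - attacked A R S"

definition defended :: "'a set \<Rightarrow> 'a rel \<Rightarrow> 'a set \<Rightarrow> 'a set" where
  "defended A R S = {a \<in> A. \<forall>b\<in>A. (b, a) \<in> R \<longrightarrow> b \<in> attacked A R S}"

definition conflict_free :: "'a set \<Rightarrow> 'a rel \<Rightarrow> 'a set \<Rightarrow> bool" where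
  "conflict_free A R S \<longleftrightarrow> S \<subseteq> neutral A R S"

definition self_defending :: "'a set \<Rightarrow> 'a rel \<Rightarrow> 'a set \<Rightarrow> bool" where
  "self_defending A R S \<longleftrightarrow> S \<subseteq> defended A R S"

definition admissible :: "'a set \<Rightarrow> 'a rel \<Rightarrow> 'a set \<Rightarrow> bool" where
  "admissible A R S \<longleftrightarrow> S \<subseteq> A \<and> conflict_free A R S \<and> self_defending A R S"

definition complete_extension :: "'a set \<Rightarrow> 'a rel \<Rightarrow> 'a set \<Rightarrow> bool" where
  "complete_extension A R S \<longleftrightarrow> admissible A R S \<and> defended A R S \<subseteq> S"

text \<open>
  The grounded extension is rendered as a predicate rather than by \<open>THE\<close> or \<open>LEAST\<close>, so that
  the existence of a least complete extension is not presupposed; uniqueness is immediate by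
  antisymmetry of inclusion.
\<close>

definition grounded_extension :: "'a set \<Rightarrow> 'a rel \<Rightarrow> 'a set \<Rightarrow> bool" where
  "grounded_extension A R G \<longleftrightarrow>
     complete_extension A R G \<and> (\<forall>S. complete_extension A R S \<longrightarrow> G \<subseteq> S)"

end

theory Submission imports Defs begin

text \<open>
  Since \<open>d = u \<circ> u\<close>, subsolutions and complete extensions are the same sets. Let \<open>L\<close> be the
  least fixed point of the monotone operator \<open>u \<circ> u\<close>. Then \<open>u(L)\<close> is a fixed point too, so
  \<open>L \<subseteq> u(L)\<close> by minimality. Thus \<open>L\<close> is itself a subsolution, hence the least one.
\<close>

lemma antimono_undominated: "antimono (undominated X D)"
  by (auto simp: antimono_def undominated_def)

lemma mono_undominated_twice: "mono (\<lambda>S. undominated X D (undominated X D S))"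
  by (intro monoI antimonoD[OF antimono_undominated])

lemma neutral_eq_undominated: "neutral X D = undominated X D"
  by (auto simp: neutral_def attacked_def undominated_def)

text \<open>An attacker fails to be counterattacked by \<open>S\<close> exactly when it lies in
  \<open>undominated X D S\<close>.\<close>

lemma defended_eq_undominated_twice:
  "defended X D S = undominated X D (undominated X D S)"
  by (auto simp: defended_def attacked_def undominated_def)

lemma complete_extension_iff_subsolution: "complete_extension X D S \<longleftrightarrow> subsolution X D S"
  by (auto simp: complete_extension_def admissible_def conflict_free_def self_defending_def
      subsolution_def neutral_eq_undominated defended_eq_undominated_twice)

lemma subsolution_lfp: "subsolution X D (lfp (\<lambda>S. undominated X D (undominated X D S)))"
proof -
  let ?u = "undominated X D"
  let ?L = "lfp (\<lambda>S. ?u (?u S))"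
  have fixpoint: "?L = ?u (?u ?L)"
    by (rule lfp_unfold[OF mono_undominated_twice])
  have "?L \<subseteq> ?u ?L"
    by (rule lfp_lowerbound) (simp flip: fixpoint)
  \<comment> \<open>Supplies the carrier condition \<open>?L \<subseteq> X\<close>.\<close>
  moreover have "?u ?L \<subseteq> X"
    by (simp add: undominated_def)
  ultimately show ?thesis
    using fixpoint by (auto simp: subsolution_def)
qed

text \<open>Subsolutions are not closed under intersection in general; this intersection is one
  because the family has a least member.\<close>

lemma subsolution_supercore: "subsolution X D (supercore X D)"
proof -
  let ?L = "lfp (\<lambda>S. undominated X D (undominated X D S))"
  have "?L \<subseteq> S" if "subsolution X D S" for S
    using that by (intro lfp_lowerbound) (simp add: subsolution_def)
  then have "supercore X D = ?L"
    using subsolution_lfp[of X D] by (auto simp: supercore_def)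
  then show ?thesis
    using subsolution_lfp[of X D] by simp
qed

theorem theorem5:
  fixes X :: "'a set" and D :: "'a rel" and G :: "'a set"
  assumes "abstract_game X D"
  shows "grounded_extension X D G \<longleftrightarrow> supercore X D = G"
proof -
  have "supercore X D \<subseteq> S" if "subsolution X D S" for S
    using that by (auto simp: supercore_def)
  \<comment> \<open>Antisymmetry of inclusion makes any grounded \<open>G\<close> equal to the least
    subsolution.\<close>
  then show ?thesis
    using subsolution_supercore[of X D]
    unfolding grounded_extension_def complete_extension_iff_subsolution by blast
qed

end
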